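(* Let $\Lambda\subseteq\{\mathsf{N},\mathsf{C},\mathsf{P},\mathsf{D},\mathsf{4}\}$ and assume $\{\mathsf{N},\mathsf{D}\}\nsubseteq\Lambda$. For any modal formula $A$, the following are equivalent: (1) $L_\Lambda\vdash A$. (2) $A$ is valid in all closure models satisfying the conditions $(\mathsf{X})$ for all $\mathsf{X}\in\Lambda$. (3) $A$ is valid in all primitive recursively presented finite closure models satisfying the conditions $(\mathsf{X})$ for all $\mathsf{X}\in\Lambda$.
   Context: Modal formulas are built from propositional variables $p_0,p_1,\ldots$ and $\bot$ by $\neg,\land,\lor,\to,\Box$; $\mathrm{MF}$ is the set of all modal formulas. A modal logic is a set $L\subseteq\mathrm{MF}$ containing all classical tautologies and closed under Modus Ponens and uniform substitution; $L\vdash A$ means $A\in L$. Consider the rule Nec (from $A$ infer $\Box A$), the schemes $\mathsf{C}$: $\Box A\land\Box B\to\Box(A\land B)$, $\mathsf{D}$: $\neg(\Box A\land\Box\neg A)$, $\mathsf{4}$: $\Box A\to\Box\Box A$, and the axiom $\mathsf{P}$: $\neg\Box\bot$. $L_\Lambda$ is the smallest modal logic that is closed under Nec if $\mathsf{N}\in\Lambda$ and contains (all instances of) each of $\mathsf{C},\mathsf{P},\mathsf{D},\mathsf{4}$ belonging to $\Lambda$. A closure operator is a map $\mathrm{cl}:\mathcal{P}(\mathrm{MF})\to\mathcal{P}(\mathrm{MF})$ with $X\subseteq\mathrm{cl}(X)$; $X\subseteq Y\Rightarrow\mathrm{cl}(X)\subseteq\mathrm{cl}(Y)$; $\mathrm{cl}(\mathrm{cl}(X))=\mathrm{cl}(X)$.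 A closure frame is a triple $(W,G,\mathrm{cl})$ with $W$ a non-empty set, $G:W\to\mathcal{P}(\mathrm{MF})$, and $\mathrm{cl}$ a closure operator; it is finite if $W$ is finite and every $G(x)$ is finite. A closure model $\mathcal{M}=(W,G,\mathrm{cl},\Vdash)$ is a closure frame with a relation $\Vdash$ between $W$ and $\mathrm{MF}$ obeying the usual pointwise Boolean clauses for $\bot,\neg,\land,\lor,\to$, and $x\Vdash\Box A\iff A\in\mathrm{cl}(G(x))$; it is finite if its frame is. $A$ is valid in $\mathcal{M}$ ($\mathcal{M}\models A$) if $x\Vdash A$ for all $x\in W$. $\mathcal{M}$ is primitive recursively presented if the relations $x\in W$, $x\Vdash p$ (for propositional variables $p$), and $B\in\mathrm{cl}(G(x))$ are primitive recursive (worlds and formulas being coded by natural numbers). $\mathcal{M}$ satisfies: $(\mathsf{N})$ if for all $x\in W$, $A\in\mathrm{MF}$: $\mathcal{M}\models A$ implies $A\in\mathrm{cl}(G(x))$; $(\mathsf{C})$ if for all $x\in W$, $A,B\in\mathrm{MF}$: $A,B\in\mathrm{cl}(G(x))$ implies $A\land B\in\mathrm{cl}(G(x))$; $(\mathsf{4})$ if for all $x\in W$, $A\in\mathrm{MF}$: $A\in\mathrm{cl}(G(x))$ implies $\Box A\in\mathrm{cl}(G(x))$; $(\mathsf{P})$ if for all $x\in W$: $\bot\notin\mathrm{cl}(G(x))$; $(\mathsf{D})$ if for all $x\in W$, $A\in\mathrm{MF}$: $A\in\mathrm{cl}(G(x))$ implies $\neg A\notin\mathrm{cl}(G(x))$.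 *)

theory Defs
  imports Main "HOL-Library.Nat_Bijection"
begin

section \<open>Modal formulas and the logics\<close>

datatype fm =
    Var nat
  | Bot
  | Neg fm
  | And fm fm
  | Or fm fm
  | Imp fm fm
  | Box fm

primrec subst :: "(nat \<Rightarrow> fm) \<Rightarrow> fm \<Rightarrow> fm" where
  "subst s (Var n) = s n"
| "subst s Bot = Bot"
| "subst s (Neg A) = Neg (subst s A)"
| "subst s (And A B) = And (subst s A) (subst s B)"
| "subst s (Or A B) = Or (subst s A) (subst s B)"
| "subst s (Imp A B) = Imp (subst s A) (subst s B)"
| "subst s (Box A) = Box (subst s A)"

definition boolean_clauses :: "(fm \<Rightarrow> bool) \<Rightarrow> bool" where
  "boolean_clauses v \<longleftrightarrow>
     \<not> v Bot \<and>
     (\<forall>A. v (Neg A) \<longleftrightarrow> \<not> v A) \<and>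
     (\<forall>A B. v (And A B) \<longleftrightarrow> v A \<and> v B) \<and>
     (\<forall>A B. v (Or A B) \<longleftrightarrow> v A \<or> v B) \<and>
     (\<forall>A B. v (Imp A B) \<longleftrightarrow> (v A \<longrightarrow> v B))"

(* The values of v on variables and on boxed formulas are unconstrained, so a
   boxed formula is treated as a propositional atom.  In a set closed under
   substitution this amounts to the box-free tautologies. *)
definition tautology :: "fm \<Rightarrow> bool" where
  "tautology A \<longleftrightarrow> (\<forall>v. boolean_clauses v \<longrightarrow> v A)"

definition modal_logic :: "fm set \<Rightarrow> bool" where
  "modal_logic L \<longleftrightarrow>
     (\<forall>A. tautology A \<longrightarrow> A \<in> L) \<and>
     (\<forall>A B. A \<in> L \<longrightarrow> Imp A B \<in> L \<longrightarrow> B \<in> L) \<and>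
     (\<forall>A s. A \<in> L \<longrightarrow> subst s A \<in> L)"

datatype principle = N | C | P | D | Four

fun obeys :: "fm set \<Rightarrow> principle \<Rightarrow> bool" where
  "obeys L N \<longleftrightarrow> (\<forall>A. A \<in> L \<longrightarrow> Box A \<in> L)"
| "obeys L C \<longleftrightarrow> (\<forall>A B. Imp (And (Box A) (Box B)) (Box (And A B)) \<in> L)"
| "obeys L P \<longleftrightarrow> Neg (Box Bot) \<in> L"
| "obeys L D \<longleftrightarrow> (\<forall>A. Neg (And (Box A) (Box (Neg A))) \<in> L)"
| "obeys L Four \<longleftrightarrow> (\<forall>A. Imp (Box A) (Box (Box A)) \<in> L)"

definition logic :: "principle set \<Rightarrow> fm set" where
  "logic \<Lambda> = \<Inter> {L. modal_logic L \<and> (\<forall>X\<in>\<Lambda>. obeys L X)}"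

lemma modal_logic_logic: "modal_logic (logic \<Lambda>)"
  unfolding logic_def modal_logic_def by blast

lemma obeys_logic:
  assumes "X \<in> \<Lambda>"
  shows "obeys (logic \<Lambda>) X"
  using assms by (cases X) (fastforce simp: logic_def)+

section \<open>Closure models\<close>

definition closure_operator :: "(fm set \<Rightarrow> fm set) \<Rightarrow> bool" where
  "closure_operator c \<longleftrightarrow> (\<forall>X. X \<subseteq> c X) \<and> mono c \<and> (\<forall>X. c (c X) = c X)"

(* gen and forces are total on the type of worlds; only their values at
   elements of worlds are ever used.  Quantifying over all models with worlds in
   an arbitrary infinite type 'w loses nothing: every closure model has an
   isomorphic copy over some infinite type, and every finite one has a copy
   over each infinite type. *)
record 'w closure_model =
  worlds :: "'w set"
  gen :: "'w \<Rightarrow> fm set"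
  clo :: "fm set \<Rightarrow> fm set"
  forces :: "'w \<Rightarrow> fm \<Rightarrow> bool"

definition closure_model :: "'w closure_model \<Rightarrow> bool" where
  "closure_model M \<longleftrightarrow>
     worlds M \<noteq> {} \<and>
     closure_operator (clo M) \<and>
     (\<forall>x\<in>worlds M. boolean_clauses (forces M x)) \<and>
     (\<forall>x\<in>worlds M. \<forall>A. forces M x (Box A) \<longleftrightarrow> A \<in> clo M (gen M x))"

definition finite_model :: "'w closure_model \<Rightarrow> bool" where
  "finite_model M \<longleftrightarrow> finite (worlds M) \<and> (\<forall>x\<in>worlds M. finite (gen M x))"

definition valid :: "'w closure_model \<Rightarrow> fm \<Rightarrow> bool" where
  "valid M A \<longleftrightarrow> (\<forall>x\<in>worlds M. forces M x A)"

fun satisfies :: "'w closure_model \<Rightarrow> principle \<Rightarrow> bool" where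
  "satisfies M N \<longleftrightarrow>
     (\<forall>x\<in>worlds M. \<forall>A. valid M A \<longrightarrow> A \<in> clo M (gen M x))"
| "satisfies M C \<longleftrightarrow>
     (\<forall>x\<in>worlds M. \<forall>A B. A \<in> clo M (gen M x) \<and> B \<in> clo M (gen M x) \<longrightarrow>
        And A B \<in> clo M (gen M x))"
| "satisfies M P \<longleftrightarrow> (\<forall>x\<in>worlds M. Bot \<notin> clo M (gen M x))"
| "satisfies M D \<longleftrightarrow>
     (\<forall>x\<in>worlds M. \<forall>A. A \<in> clo M (gen M x) \<longrightarrow> Neg A \<notin> clo M (gen M x))"
| "satisfies M Four \<longleftrightarrow>
     (\<forall>x\<in>worlds M. \<forall>A. A \<in> clo M (gen M x) \<longrightarrow> Box A \<in> clo M (gen M x))"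

section \<open>Primitive recursive presentations\<close>

(* prim_rec n f: on argument lists of length n, f is a primitive recursive
   function of n arguments; values on lists of other lengths are irrelevant. *)
inductive prim_rec :: "nat \<Rightarrow> (nat list \<Rightarrow> nat) \<Rightarrow> bool" where
  zero: "prim_rec n (\<lambda>_. 0)"
| succ: "prim_rec 1 (\<lambda>xs. Suc (xs ! 0))"
| proj: "i < n \<Longrightarrow> prim_rec n (\<lambda>xs. xs ! i)"
| comp: "prim_rec (length gs) f \<Longrightarrow> (\<And>g. g \<in> set gs \<Longrightarrow> prim_rec n g) \<Longrightarrow>
    prim_rec n (\<lambda>xs. f (map (\<lambda>g. g xs) gs))"
| recur: "prim_rec n f \<Longrightarrow> prim_rec (Suc (Suc n)) g \<Longrightarrow>
    prim_rec (Suc n)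
      (\<lambda>xs. rec_nat (f (tl xs)) (\<lambda>y r. g (y # r # tl xs)) (hd xs))"

definition prim_rec_set :: "nat set \<Rightarrow> bool" where
  "prim_rec_set S \<longleftrightarrow> (\<exists>f. prim_rec 1 f \<and> (\<forall>m. f [m] = (if m \<in> S then 1 else 0)))"

definition prim_rec_rel :: "(nat \<times> nat) set \<Rightarrow> bool" where
  "prim_rec_rel R \<longleftrightarrow>
     (\<exists>f. prim_rec 2 f \<and> (\<forall>m n. f [m, n] = (if (m, n) \<in> R then 1 else 0)))"

primrec fm_code :: "fm \<Rightarrow> nat" where
  "fm_code (Var n) = prod_encode (0, n)"
| "fm_code Bot = prod_encode (1, 0)"
| "fm_code (Neg A) = prod_encode (2, fm_code A)"
| "fm_code (And A B) = prod_encode (3, prod_encode (fm_code A, fm_code B))"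
| "fm_code (Or A B) = prod_encode (4, prod_encode (fm_code A, fm_code B))"
| "fm_code (Imp A B) = prod_encode (5, prod_encode (fm_code A, fm_code B))"
| "fm_code (Box A) = prod_encode (6, fm_code A)"

lemma fm_code_inject: "fm_code A = fm_code B \<longleftrightarrow> A = B"
proof (induction A arbitrary: B)
  case (Var n) then show ?case by (cases B) (auto simp: prod_encode_eq)
next
  case Bot then show ?case by (cases B) (auto simp: prod_encode_eq)
next
  case (Neg A) then show ?case by (cases B) (auto simp: prod_encode_eq)
next
  case (And A1 A2) then show ?case by (cases B) (auto simp: prod_encode_eq)
next
  case (Or A1 A2) then show ?case by (cases B) (auto simp: prod_encode_eq)
next
  case (Imp A1 A2) then show ?case by (cases B) (auto simp: prod_encode_eq)
next
  case (Box A) then show ?case by (cases B) (auto simp: prod_encode_eq)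
qed

(* k codes the worlds by natural numbers; codes of worlds and of formulas are
   the arguments of the relations required to be primitive recursive. *)
definition prim_rec_presented :: "'w closure_model \<Rightarrow> bool" where
  "prim_rec_presented M \<longleftrightarrow>
     (\<exists>k :: 'w \<Rightarrow> nat. inj_on k (worlds M) \<and>
        prim_rec_set (k ` worlds M) \<and>
        prim_rec_rel {(k x, fm_code (Var n)) | x n. x \<in> worlds M \<and> forces M x (Var n)} \<and>
        prim_rec_rel {(k x, fm_code B) | x B. x \<in> worlds M \<and> B \<in> clo M (gen M x)})"

end

theory Submission
  imports Defs
begin

text \<open>
  Soundness: for a model \<open>M\<close> satisfying the conditions, the formulas all of whose substitution
  instances are valid in \<open>M\<close> form a modal logic obeying \<open>\<Lambda>\<close> (lemma \<open>soundness\<close>).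

  Completeness: let \<open>A\<close> be unprovable and let \<open>S\<close> consist of \<open>Bot\<close> and the subformulas of \<open>A\<close>.
  The worlds of the countermodel are finitely many maximal consistent theories that realise all
  possible traces of such theories on \<open>S\<close>. Since none of the logics under consideration need
  contain any congruence or monotonicity principle for \<open>Box\<close>, the boxes of formulas outside \<open>S\<close>
  can be decided arbitrarily as far as the truth lemma is concerned. The closure operator is
  \<open>X \<mapsto> X \<union> E\<close> for one fixed set \<open>E\<close> of formulas outside \<open>S\<close>, and \<open>G(x)\<close> consists of those
  \<open>B \<in> S\<close> with \<open>Box B\<close> in the theory \<open>x\<close>. If \<open>N\<close> is in \<open>\<Lambda>\<close>, then \<open>E\<close> contains all formulas
  outside \<open>S\<close>, so condition (N) has to be checked for elements of \<open>S\<close> only, where validity in the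
  model is provability. If \<open>N\<close> is not in \<open>\<Lambda>\<close>, then \<open>E\<close> contains those formulas outside \<open>S\<close> that
  are not negations: a negation in the closure of \<open>G(x)\<close> then lies in \<open>S\<close> together with the negated
  formula, so condition (D) reduces to the axiom \<open>D\<close> for a formula in \<open>S\<close>. In both cases \<open>E\<close> contains
  every conjunction and every boxed formula outside \<open>S\<close>, which reduces (C) and (4) to \<open>S\<close> as well
  (lemma \<open>satisfies_countermodel\<close>).

  The closure of \<open>G(x)\<close> differs by a finite set from the set of all formulas or of all non-negated
  formulas. Hence the countermodel is primitive recursively presented as soon as the set of codes
  of formulas is primitive recursive (lemma \<open>pre_fm_code\<close>), which is shown by course-of-values
  recursion along the pairing function.
\<close>

section \<open>Soundness\<close>

lemma subst_subst: "subst s (subst t A) = subst (\<lambda>n. subst s (t n)) A"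
  by (induction A) auto

lemma subst_Var: "subst Var A = A"
  by (induction A) auto

lemma tautology_subst:
  assumes "tautology A"
  shows "tautology (subst s A)"
  unfolding tautology_def
proof (intro allI impI)
  fix v assume v: "boolean_clauses v"
  have "boolean_clauses (\<lambda>B. v (subst s B))"
    using v by (simp add: boolean_clauses_def)
  then show "v (subst s A)"
    using assms by (auto simp: tautology_def)
qed

lemma soundness:
  fixes M :: "'w closure_model"
  assumes A: "A \<in> logic \<Lambda>" and M: "closure_model M" "\<forall>X\<in>\<Lambda>. satisfies M X"
  shows "valid M A"
proof -
  define L where "L = {B. \<forall>s. valid M (subst s B)}"
  have bc: "boolean_clauses (forces M x)" if "x \<in> worlds M" for x
    using M that by (simp add: closure_model_def)
  have box: "forces M x (Box B) \<longleftrightarrow> B \<in> clo M (gen M x)" if "x \<in> worlds M" for x B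
    using M that by (simp add: closure_model_def)
  have bool: "forces M x (Neg B) \<longleftrightarrow> \<not> forces M x B" "\<not> forces M x Bot"
    "forces M x (And B B') \<longleftrightarrow> forces M x B \<and> forces M x B'"
    "forces M x (Imp B B') \<longleftrightarrow> (forces M x B \<longrightarrow> forces M x B')"
    if "x \<in> worlds M" for x B B'
    using bc[OF that] by (simp_all add: boolean_clauses_def)
  have "modal_logic L"
    unfolding modal_logic_def L_def
  proof (intro conjI allI impI; (simp only: mem_Collect_eq; intro allI)?)
    fix B s assume "tautology B"
    then have "tautology (subst s B)" by (rule tautology_subst)
    then show "valid M (subst s B)"
      using bc by (auto simp: valid_def tautology_def)
  next
    fix B B' s
    assume "\<forall>s. valid M (subst s B)" "\<forall>s. valid M (subst s (Imp B B'))"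
    then have "valid M (subst s B)" "valid M (subst s (Imp B B'))" by blast+
    then show "valid M (subst s B')"
      by (auto simp: valid_def bool)
  next
    fix B t s
    assume "\<forall>s. valid M (subst s B)"
    then show "valid M (subst s (subst t B))"
      by (simp add: subst_subst)
  qed
  moreover have "obeys L X" if "X \<in> \<Lambda>" for X
  proof -
    have "satisfies M X" using M that by blast
    then show ?thesis
      by (cases X) (auto simp: L_def valid_def bool box)
  qed
  ultimately have "A \<in> L"
    using A unfolding logic_def by blast
  then have "valid M (subst Var A)" by (auto simp: L_def)
  then show ?thesis by (simp add: subst_Var)
qed

section \<open>Maximal consistent theories\<close>

text \<open>The maximal consistent theories over \<open>L\<close>, represented by their characteristic functions.\<close>

definition theory_valuations :: "fm set \<Rightarrow> (fm \<Rightarrow> bool) set" where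
  "theory_valuations L = {v. boolean_clauses v \<and> (\<forall>B\<in>L. v B)}"

text \<open>The Lindenbaum lemma. By Zorn there is a maximal set containing \<open>L\<close>, closed under Modus
  Ponens and omitting \<open>A\<close>; for \<open>B\<close> outside of it the set of all \<open>D\<close> with \<open>B \<rightarrow> D\<close> in it is
  a larger closed set, hence \<open>B \<rightarrow> A\<close> is in it.\<close>

lemma lindenbaum:
  assumes L: "modal_logic L" and A: "A \<notin> L"
  obtains v where "v \<in> theory_valuations L" "\<not> v A"
proof -
  have taut: "B \<in> L" if "tautology B" for B
    using L that by (simp add: modal_logic_def)
  define closed where "closed T \<longleftrightarrow> (\<forall>B D. B \<in> T \<longrightarrow> Imp B D \<in> T \<longrightarrow> D \<in> T)" for T
  define F where "F = {T. L \<subseteq> T \<and> closed T \<and> A \<notin> T}"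
  have "L \<in> F"
    using L A unfolding F_def closed_def modal_logic_def by blast
  have chain: "\<Union>\<C> \<in> F" if "\<C> \<noteq> {}" "subset.chain F \<C>" for \<C>
  proof -
    have sub: "\<C> \<subseteq> F" and lin: "\<And>S T. S \<in> \<C> \<Longrightarrow> T \<in> \<C> \<Longrightarrow> S \<subseteq> T \<or> T \<subseteq> S"
      using that(2) by (auto simp: subset_chain_def)
    have "closed (\<Union>\<C>)"
      unfolding closed_def
    proof (intro allI impI)
      fix B D assume "B \<in> \<Union>\<C>" "Imp B D \<in> \<Union>\<C>"
      then obtain S T where "S \<in> \<C>" "B \<in> S" "T \<in> \<C>" "Imp B D \<in> T" by blast
      then obtain U where "U \<in> \<C>" "B \<in> U" "Imp B D \<in> U"
        using lin by blast
      moreover have "closed U" using sub \<open>U \<in> \<C>\<close> by (auto simp: F_def)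
      ultimately show "D \<in> \<Union>\<C>" unfolding closed_def by blast
    qed
    then show ?thesis using sub that(1) by (auto simp: F_def)
  qed
  have "\<exists>T\<in>F. \<forall>X\<in>F. T \<subseteq> X \<longrightarrow> X = T"
    by (rule subset_Zorn_nonempty) (use \<open>L \<in> F\<close> chain in auto)
  then obtain T where T: "T \<in> F" and max: "\<And>X. X \<in> F \<Longrightarrow> T \<subseteq> X \<Longrightarrow> X = T" by blast
  have LT: "L \<subseteq> T" and AT: "A \<notin> T" using T by (auto simp: F_def)
  have mp: "D \<in> T" if "B \<in> T" "Imp B D \<in> T" for B D
    using T that unfolding F_def closed_def by blast
  have tautT: "B \<in> T" if "tautology B" for B using taut that LT by blast
  have mp1: "D \<in> T" if "B \<in> T" "tautology (Imp B D)" for B D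
    using mp that tautT by blast
  have mp2: "D \<in> T" if "B \<in> T" "B' \<in> T" "tautology (Imp B (Imp B' D))" for B B' D
    using mp that tautT by blast
  note bt = tautology_def boolean_clauses_def
  have ImpA: "Imp B A \<in> T" if "B \<notin> T" for B
  proof (rule ccontr)
    assume "Imp B A \<notin> T"
    let ?X = "{D. Imp B D \<in> T}"
    have sub: "T \<subseteq> ?X"
    proof
      fix D assume "D \<in> T"
      then have "Imp B D \<in> T" by (rule mp1) (auto simp: bt)
      then show "D \<in> ?X" by simp
    qed
    have "closed ?X"
      unfolding closed_def
    proof (intro allI impI)
      fix D D' assume "D \<in> ?X" "Imp D D' \<in> ?X"
      then have "Imp B D \<in> T" "Imp B (Imp D D') \<in> T" by auto
      then have "Imp B D' \<in> T" by (rule mp2) (auto simp: bt)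
      then show "D' \<in> ?X" by simp
    qed
    then have "?X \<in> F" using sub LT \<open>Imp B A \<notin> T\<close> by (auto simp: F_def)
    then have "?X = T" using max sub by blast
    moreover have "B \<in> ?X" using tautT[of "Imp B B"] by (auto simp: bt)
    ultimately show False using that by blast
  qed
  have Neg: "Neg B \<in> T \<longleftrightarrow> B \<notin> T" for B
  proof
    assume "Neg B \<in> T"
    show "B \<notin> T"
    proof
      assume "B \<in> T"
      then have "A \<in> T" using \<open>Neg B \<in> T\<close> by (rule mp2) (auto simp: bt)
      then show False using AT by simp
    qed
  next
    assume "B \<notin> T"
    show "Neg B \<in> T"
    proof (rule ccontr)
      assume "Neg B \<notin> T"
      from ImpA[OF \<open>B \<notin> T\<close>] ImpA[OF this] have "A \<in> T" by (rule mp2) (auto simp: bt)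
      then show False using AT by simp
    qed
  qed
  have Bot: "Bot \<notin> T"
  proof
    assume "Bot \<in> T"
    then have "A \<in> T" by (rule mp1) (auto simp: bt)
    then show False using AT by simp
  qed
  have And: "And B D \<in> T \<longleftrightarrow> B \<in> T \<and> D \<in> T" for B D
  proof -
    have "B \<in> T" if "And B D \<in> T" using that by (rule mp1) (auto simp: bt)
    moreover have "D \<in> T" if "And B D \<in> T" using that by (rule mp1) (auto simp: bt)
    moreover have "And B D \<in> T" if "B \<in> T" "D \<in> T" using that by (rule mp2) (auto simp: bt)
    ultimately show ?thesis by blast
  qed
  have Or: "Or B D \<in> T \<longleftrightarrow> B \<in> T \<or> D \<in> T" for B D
  proof -
    have "Or B D \<in> T" if "B \<in> T" using that by (rule mp1) (auto simp: bt)
    moreover have "Or B D \<in> T" if "D \<in> T" using that by (rule mp1) (auto simp: bt)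
    moreover have "D \<in> T" if "Or B D \<in> T" "Neg B \<in> T" using that by (rule mp2) (auto simp: bt)
    ultimately show ?thesis using Neg by blast
  qed
  have Imp: "Imp B D \<in> T \<longleftrightarrow> (B \<in> T \<longrightarrow> D \<in> T)" for B D
  proof -
    have "Imp B D \<in> T" if "Neg B \<in> T" using that by (rule mp1) (auto simp: bt)
    moreover have "Imp B D \<in> T" if "D \<in> T" using that by (rule mp1) (auto simp: bt)
    ultimately show ?thesis using Neg mp by blast
  qed
  have "(\<lambda>B. B \<in> T) \<in> theory_valuations L"
    using Bot Neg And Or Imp LT by (auto simp: theory_valuations_def boolean_clauses_def)
  then show ?thesis using that AT by blast
qed

text \<open>Up to agreement on a finite set of formulas there are only finitely many valuations, so they
  have finitely many representatives, which can be indexed by elements of any infinite type.\<close>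

lemma finite_representatives:
  fixes V :: "(fm \<Rightarrow> bool) set"
  assumes "infinite (UNIV :: 'w set)" and K: "finite K"
  obtains W :: "'w set" and r where "finite W" "\<And>x. x \<in> W \<Longrightarrow> r x \<in> V"
    "\<And>v. v \<in> V \<Longrightarrow> \<exists>x\<in>W. \<forall>B\<in>K. r x B = v B"
proof -
  let ?t = "\<lambda>v. {B \<in> K. v B}"
  have fin: "finite (?t ` V)"
    by (rule finite_subset[of _ "Pow K"]) (use K in auto)
  obtain W :: "'w set" where W: "finite W" "card W = card (?t ` V)"
    using infinite_arbitrarily_large[OF assms(1)] by blast
  then obtain e where e: "bij_betw e W (?t ` V)"
    using fin by (metis finite_same_card_bij)
  define r where "r x = (SOME v. v \<in> V \<and> ?t v = e x)" for x
  have r: "r x \<in> V \<and> ?t (r x) = e x" if "x \<in> W" for x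
  proof -
    have "e x \<in> ?t ` V" using e that by (auto simp: bij_betw_def)
    then have "\<exists>v. v \<in> V \<and> ?t v = e x" by auto
    then show ?thesis unfolding r_def by (rule someI_ex)
  qed
  have "\<exists>x\<in>W. \<forall>B\<in>K. r x B = v B" if "v \<in> V" for v
  proof -
    have "?t v \<in> e ` W" using e that by (auto simp: bij_betw_def)
    then obtain x where x: "x \<in> W" "e x = ?t v" by auto
    then have "?t (r x) = ?t v" using r by metis
    then show ?thesis using x by blast
  qed
  then show ?thesis using that W r by blast
qed

section \<open>The countermodel\<close>

text \<open>The set of all subformulas, the formula itself included.\<close>

primrec subfms :: "fm \<Rightarrow> fm set" where
  "subfms (Var n) = {Var n}"
| "subfms Bot = {Bot}"
| "subfms (Neg A) = insert (Neg A) (subfms A)"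
| "subfms (And A B) = insert (And A B) (subfms A \<union> subfms B)"
| "subfms (Or A B) = insert (Or A B) (subfms A \<union> subfms B)"
| "subfms (Imp A B) = insert (Imp A B) (subfms A \<union> subfms B)"
| "subfms (Box A) = insert (Box A) (subfms A)"

definition subformula_closed :: "fm set \<Rightarrow> bool" where
  "subformula_closed S \<longleftrightarrow> (\<forall>A\<in>S. subfms A \<subseteq> S)"

lemma finite_subfms: "finite (subfms A)"
  by (induction A) auto

lemma subfms_refl: "A \<in> subfms A"
  by (cases A) auto

lemma subfms_trans: "B \<in> subfms A \<Longrightarrow> subfms B \<subseteq> subfms A"
  by (induction A) auto

lemma subformula_closedD:
  assumes "subformula_closed S"
  shows "Neg A \<in> S \<Longrightarrow> A \<in> S" "Box A \<in> S \<Longrightarrow> A \<in> S"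
    "And A B \<in> S \<Longrightarrow> A \<in> S \<and> B \<in> S" "Or A B \<in> S \<Longrightarrow> A \<in> S \<and> B \<in> S"
    "Imp A B \<in> S \<Longrightarrow> A \<in> S \<and> B \<in> S"
  using assms subfms_refl unfolding subformula_closed_def by fastforce+

text \<open>The truth value determined by the values of variables and of boxed formulas.\<close>

primrec eval_fm :: "(nat \<Rightarrow> bool) \<Rightarrow> (fm \<Rightarrow> bool) \<Rightarrow> fm \<Rightarrow> bool" where
  "eval_fm a b (Var n) \<longleftrightarrow> a n"
| "eval_fm a b Bot \<longleftrightarrow> False"
| "eval_fm a b (Neg A) \<longleftrightarrow> \<not> eval_fm a b A"
| "eval_fm a b (And A B) \<longleftrightarrow> eval_fm a b A \<and> eval_fm a b B"
| "eval_fm a b (Or A B) \<longleftrightarrow> eval_fm a b A \<or> eval_fm a b B"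
| "eval_fm a b (Imp A B) \<longleftrightarrow> (eval_fm a b A \<longrightarrow> eval_fm a b B)"
| "eval_fm a b (Box A) \<longleftrightarrow> b A"

lemma boolean_clauses_eval_fm: "boolean_clauses (eval_fm a b)"
  by (simp add: boolean_clauses_def)

text \<open>The formulas outside \<open>S\<close> that every world of the countermodel is made to box: all of them
  if \<open>N\<close> is a principle of the logic, and otherwise those that are not negations.\<close>

definition boxed_outside :: "principle set \<Rightarrow> fm set \<Rightarrow> fm set" where
  "boxed_outside \<Lambda> S = {B. B \<notin> S \<and> (N \<in> \<Lambda> \<or> (\<forall>A. B \<noteq> Neg A))}"

text \<open>The worlds \<open>W\<close> are indices of the valuations \<open>r x\<close>, from which the model takes the values of
  variables in \<open>S\<close> and of boxes of formulas in \<open>S\<close>. Variables outside \<open>S\<close> are false.\<close>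

definition countermodel ::
  "principle set \<Rightarrow> fm set \<Rightarrow> 'w set \<Rightarrow> ('w \<Rightarrow> fm \<Rightarrow> bool) \<Rightarrow> 'w closure_model" where
  "countermodel \<Lambda> S W r =
     \<lparr>worlds = W,
      gen = (\<lambda>x. {B \<in> S. r x (Box B)}),
      clo = (\<lambda>X. X \<union> boxed_outside \<Lambda> S),
      forces = (\<lambda>x. eval_fm (\<lambda>n. Var n \<in> S \<and> r x (Var n))
        (\<lambda>B. B \<in> S \<and> r x (Box B) \<or> B \<in> boxed_outside \<Lambda> S))\<rparr>"

lemma closure_model_countermodel:
  "W \<noteq> {} \<Longrightarrow> closure_model (countermodel \<Lambda> S W r)"
  by (auto simp: closure_model_def countermodel_def closure_operator_def
      boolean_clauses_eval_fm intro!: monoI)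

lemma finite_model_countermodel:
  "finite S \<Longrightarrow> finite W \<Longrightarrow> finite_model (countermodel \<Lambda> S W r)"
  by (auto simp: finite_model_def countermodel_def)

lemma truth_lemma:
  assumes S: "subformula_closed S" and r: "boolean_clauses (r x)"
  shows "B \<in> S \<Longrightarrow> forces (countermodel \<Lambda> S W r) x B \<longleftrightarrow> r x B"
proof (induction B)
  case (Box B)
  then have "B \<in> S" using S subformula_closedD by blast
  then show ?case by (simp add: countermodel_def boxed_outside_def)
qed (use r in \<open>auto simp: countermodel_def boolean_clauses_def dest: subformula_closedD[OF S]\<close>)

text \<open>For \<open>N\<close>: a valid formula in \<open>S\<close> holds in every maximal consistent theory, since each of
  these agrees on \<open>S\<close> with some world; by the Lindenbaum lemma it is provable.\<close>

lemma satisfies_countermodel: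
  assumes S: "subformula_closed S" "Bot \<in> S"
    and nonempty: "W \<noteq> {}"
    and r: "\<And>x. x \<in> W \<Longrightarrow> r x \<in> theory_valuations (logic \<Lambda>)"
    and rep: "\<And>v. v \<in> theory_valuations (logic \<Lambda>) \<Longrightarrow> \<exists>x\<in>W. \<forall>B\<in>S. r x B = v B"
    and ND: "\<not> {N, D} \<subseteq> \<Lambda>" and X: "X \<in> \<Lambda>"
  shows "satisfies (countermodel \<Lambda> S W r) X"
proof -
  let ?M = "countermodel \<Lambda> S W r"
  have obeys: "obeys (logic \<Lambda>) X" using X by (rule obeys_logic)
  have bc: "boolean_clauses (r x)" and logic_true: "\<And>B. B \<in> logic \<Lambda> \<Longrightarrow> r x B" if "x \<in> W" for x
    using r[OF that] by (auto simp: theory_valuations_def)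
  have val: "\<not> r x Bot" "r x (Neg B) \<longleftrightarrow> \<not> r x B" "r x (And B B') \<longleftrightarrow> r x B \<and> r x B'"
    "r x (Imp B B') \<longleftrightarrow> (r x B \<longrightarrow> r x B')" if "x \<in> W" for x B B'
    using bc[OF that] by (simp_all add: boolean_clauses_def)
  have worlds [simp]: "worlds ?M = W" by (simp add: countermodel_def)
  have clo [simp]: "B \<in> clo ?M (gen ?M x) \<longleftrightarrow> B \<in> S \<and> r x (Box B) \<or> B \<in> boxed_outside \<Lambda> S"
    for x B by (simp add: countermodel_def)
  show ?thesis
  proof (cases X)
    case N
    have "r x (Box B)" if "valid ?M B" "B \<in> S" "x \<in> W" for B x
    proof -
      have "B \<in> logic \<Lambda>"
      proof (rule ccontr)
        assume "B \<notin> logic \<Lambda>"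
        then obtain v where "v \<in> theory_valuations (logic \<Lambda>)" "\<not> v B"
          using lindenbaum modal_logic_logic by blast
        then obtain y where "y \<in> W" "\<not> r y B" using rep \<open>B \<in> S\<close> by blast
        then show False
          using that truth_lemma[of S r y B, OF S(1) bc[OF \<open>y \<in> W\<close>]]
          by (auto simp: valid_def)
      qed
      then have "Box B \<in> logic \<Lambda>" using obeys N by simp
      then show ?thesis using logic_true that by blast
    qed
    then show ?thesis using N X by (auto simp: boxed_outside_def)
  next
    case C
    then have ax: "r x (Imp (And (Box B) (Box B')) (Box (And B B')))" if "x \<in> W" for x B B'
      using obeys logic_true that by simp
    then have "r x (Box (And B B'))" if "x \<in> W" "r x (Box B)" "r x (Box B')" for x B B'
      using that by (simp add: val)
    then show ?thesis
      using C by (auto simp: boxed_outside_def dest: subformula_closedD[OF S(1)])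
  next
    case P
    then have "\<not> r x (Box Bot)" if "x \<in> W" for x
      using obeys logic_true[OF that] val[OF that] by auto
    then show ?thesis using P S(2) by (auto simp: boxed_outside_def)
  next
    case D
    then have "N \<notin> \<Lambda>" using ND X by blast
    have "r x (Neg (And (Box B) (Box (Neg B))))" if "x \<in> W" for x B
      using obeys D logic_true that by simp
    then have "\<not> (r x (Box B) \<and> r x (Box (Neg B)))" if "x \<in> W" for x B
      using that by (simp add: val)
    then show ?thesis
      using D \<open>N \<notin> \<Lambda>\<close> by (auto simp: boxed_outside_def dest: subformula_closedD[OF S(1)])
  next
    case Four
    then have "r x (Imp (Box B) (Box (Box B)))" if "x \<in> W" for x B
      using obeys logic_true that by simp
    then have "r x (Box (Box B))" if "x \<in> W" "r x (Box B)" for x B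
      using that by (simp add: val)
    then show ?thesis
      using Four by (auto simp: boxed_outside_def dest: subformula_closedD[OF S(1)])
  qed
qed

section \<open>Primitive recursive functions of environments\<close>

text \<open>An \<open>n\<close>-ary function is written here as a function of an environment \<open>e\<close> assigning values to
  the argument positions, so that the arguments are \<open>e 0, \<dots>, e (n - 1)\<close>. Substitution and
  passing to parameters of a recursion then are beta reductions.\<close>

definition prim_rec_env :: "nat \<Rightarrow> ((nat \<Rightarrow> nat) \<Rightarrow> nat) \<Rightarrow> bool" where
  "prim_rec_env n F \<longleftrightarrow> (\<exists>f. prim_rec n f \<and> (\<forall>e. F e = f (map e [0..<n])))"

lemma pre_proj: "i < n \<Longrightarrow> prim_rec_env n (\<lambda>e. e i)"
  unfolding prim_rec_env_def by (intro exI[of _ "\<lambda>xs. xs ! i"]) (auto intro: prim_rec.proj)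

lemma pre_comp:
  assumes F: "prim_rec_env k F" and G: "\<And>i. i < k \<Longrightarrow> prim_rec_env n (G i)"
  shows "prim_rec_env n (\<lambda>e. F (\<lambda>i. G i e))"
proof -
  obtain f where f: "prim_rec k f" "\<And>e. F e = f (map e [0..<k])"
    using F by (auto simp: prim_rec_env_def)
  have "\<forall>i. \<exists>g. i < k \<longrightarrow> prim_rec n g \<and> (\<forall>e. G i e = g (map e [0..<n]))"
    using G by (auto simp: prim_rec_env_def)
  then obtain g where g: "\<And>i. i < k \<Longrightarrow> prim_rec n (g i) \<and> (\<forall>e. G i e = g i (map e [0..<n]))"
    by metis
  have "prim_rec n (\<lambda>xs. f (map (\<lambda>h. h xs) (map g [0..<k])))"
    by (rule prim_rec.comp) (use f g in auto)
  moreover have "F (\<lambda>i. G i e) = f (map (\<lambda>h. h (map e [0..<n])) (map g [0..<k]))" for e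
    using g by (auto simp: f o_def intro!: arg_cong[of _ _ f])
  ultimately show ?thesis unfolding prim_rec_env_def by blast
qed

lemma pre_comp1:
  assumes "prim_rec_env 1 (\<lambda>e. h (e 0))" "prim_rec_env n f"
  shows "prim_rec_env n (\<lambda>e. h (f e))"
  using pre_comp[OF assms(1), where G = "\<lambda>_. f"] assms(2) by simp

lemma pre_comp2:
  assumes "prim_rec_env 2 (\<lambda>e. h (e 0) (e 1))" "prim_rec_env n f" "prim_rec_env n g"
  shows "prim_rec_env n (\<lambda>e. h (f e) (g e))"
  using pre_comp[OF assms(1), where G = "\<lambda>i. if i = 0 then f else g"] assms(2,3) by simp

lemma pre_Suc: "prim_rec_env n f \<Longrightarrow> prim_rec_env n (\<lambda>e. Suc (f e))"
  by (rule pre_comp1[where h = Suc])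
    (auto simp: prim_rec_env_def intro!: exI[of _ "\<lambda>xs. Suc (xs ! 0)"] prim_rec.succ[simplified])

lemma pre_const: "prim_rec_env n (\<lambda>_. c)"
proof (induction c)
  case 0
  show ?case
    unfolding prim_rec_env_def by (intro exI[of _ "\<lambda>_. 0"]) (auto intro: prim_rec.zero)
qed (rule pre_Suc)

text \<open>Primitive recursion with an arbitrary recursion bound \<open>b\<close>. In the premise on the step function,
  the positions \<open>0\<close> and \<open>1\<close> hold the counter and the previous value, and the original
  environment is shifted by two.\<close>

lemma pre_rec:
  assumes F: "prim_rec_env n F"
    and G: "prim_rec_env (Suc (Suc n)) (\<lambda>e. G (\<lambda>i. e (Suc (Suc i))) (e 0) (e 1))"
    and b: "prim_rec_env n b"
  shows "prim_rec_env n (\<lambda>e. rec_nat (F e) (\<lambda>y z. G e y z) (b e))"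
proof -
  obtain f where f: "prim_rec n f" "\<And>e. F e = f (map e [0..<n])"
    using F by (auto simp: prim_rec_env_def)
  obtain g where g: "prim_rec (Suc (Suc n)) g"
    "\<And>e. G (\<lambda>i. e (Suc (Suc i))) (e 0) (e 1) = g (map e [0..<Suc (Suc n)])"
    using G unfolding prim_rec_env_def by blast
  \<comment> \<open>the environment \<open>y, z, e 0, e 1, \<dots>\<close>\<close>
  have G_eq: "G e y z = g (y # z # map e [0..<n])" for e y z
    using g(2)[of "case_nat y (case_nat z e)"]
    by (simp add: map_upt_Suc del: upt_Suc)
  have "prim_rec (Suc n) (\<lambda>xs. rec_nat (f (tl xs)) (\<lambda>y z. g (y # z # tl xs)) (hd xs))"
    by (rule prim_rec.recur) (use f g in auto)
  moreover have "rec_nat (F (\<lambda>i. e (Suc i))) (\<lambda>y z. G (\<lambda>i. e (Suc i)) y z) (e 0) =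
      (\<lambda>xs. rec_nat (f (tl xs)) (\<lambda>y z. g (y # z # tl xs)) (hd xs)) (map e [0..<Suc n])" for e
    unfolding G_eq f(2) by (simp add: map_upt_Suc del: upt_Suc)
  ultimately have "prim_rec_env (Suc n)
      (\<lambda>e. rec_nat (F (\<lambda>i. e (Suc i))) (\<lambda>y z. G (\<lambda>i. e (Suc i)) y z) (e 0))"
    unfolding prim_rec_env_def by blast
  from pre_comp[OF this, where G = "\<lambda>i. case i of 0 \<Rightarrow> b | Suc j \<Rightarrow> (\<lambda>e. e j)" and n = n]
  show ?thesis using b by (simp add: pre_proj split: nat.split)
qed

named_theorems pre_intros

lemmas [pre_intros] = pre_proj pre_const pre_Suc

lemma pre_add [pre_intros]:
  assumes "prim_rec_env n f" "prim_rec_env n g"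
  shows "prim_rec_env n (\<lambda>e. f e + g e)"
proof -
  have "rec_nat a (\<lambda>_ z. Suc z) b = a + b" for a b by (induction b) auto
  moreover have "prim_rec_env n (\<lambda>e. rec_nat (f e) (\<lambda>_ z. Suc z) (g e))"
    by (intro pre_rec pre_intros assms) simp
  ultimately show ?thesis by simp
qed

lemma pre_mult [pre_intros]:
  assumes "prim_rec_env n f" "prim_rec_env n g"
  shows "prim_rec_env n (\<lambda>e. f e * g e)"
proof (rule pre_comp2[OF _ assms])
  have "rec_nat 0 (\<lambda>_ z. z + a) b = a * b" for a b :: nat by (induction b) auto
  moreover have "prim_rec_env 2 (\<lambda>e. rec_nat 0 (\<lambda>_ z. z + e 0) (e 1))"
    by (intro pre_rec pre_intros) auto
  ultimately show "prim_rec_env 2 (\<lambda>e. e 0 * e 1)" by simp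
qed

lemma pre_diff [pre_intros]:
  assumes "prim_rec_env n f" "prim_rec_env n g"
  shows "prim_rec_env n (\<lambda>e. f e - g e)"
proof (rule pre_comp2[OF _ assms])
  have "rec_nat 0 (\<lambda>y _. y) a = a - 1" for a :: nat by (cases a) auto
  moreover have "prim_rec_env 1 (\<lambda>e. rec_nat 0 (\<lambda>y _. y) (e 0))"
    by (intro pre_rec pre_intros) auto
  ultimately have pred: "prim_rec_env 1 (\<lambda>e. e 0 - 1)" by simp
  have "rec_nat a (\<lambda>_ z. z - 1) b = a - b" for a b :: nat by (induction b) auto
  moreover have "prim_rec_env 2 (\<lambda>e. rec_nat (e 0) (\<lambda>_ z. z - 1) (e 1))"
    by (intro pre_rec pre_intros pre_comp1[OF pred]) auto
  ultimately show "prim_rec_env 2 (\<lambda>e. e 0 - e 1)" by simp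
qed

text \<open>A relation is primitive recursive if its characteristic function is.\<close>

abbreviation prim_rec_env_pred :: "nat \<Rightarrow> ((nat \<Rightarrow> nat) \<Rightarrow> bool) \<Rightarrow> bool" where
  "prim_rec_env_pred n Q \<equiv> prim_rec_env n (\<lambda>e. of_bool (Q e))"

lemma pre_conj [pre_intros]:
  "prim_rec_env_pred n Q \<Longrightarrow> prim_rec_env_pred n R \<Longrightarrow> prim_rec_env_pred n (\<lambda>e. Q e \<and> R e)"
  unfolding of_bool_conj by (rule pre_mult)

lemma pre_not [pre_intros]:
  assumes "prim_rec_env_pred n Q"
  shows "prim_rec_env_pred n (\<lambda>e. \<not> Q e)"
proof -
  have "prim_rec_env n (\<lambda>e. 1 - of_bool (Q e))" by (intro pre_intros assms)
  moreover have "1 - of_bool (Q e) = (of_bool (\<not> Q e) :: nat)" for e by simp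
  ultimately show ?thesis by (simp only:)
qed

lemma pre_disj [pre_intros]:
  assumes "prim_rec_env_pred n Q" "prim_rec_env_pred n R"
  shows "prim_rec_env_pred n (\<lambda>e. Q e \<or> R e)"
proof -
  have "prim_rec_env_pred n (\<lambda>e. \<not> (\<not> Q e \<and> \<not> R e))" by (intro pre_not pre_conj assms)
  then show ?thesis by simp
qed

lemma pre_le [pre_intros]:
  assumes "prim_rec_env n f" "prim_rec_env n g"
  shows "prim_rec_env_pred n (\<lambda>e. f e \<le> g e)"
proof -
  have "prim_rec_env n (\<lambda>e. 1 - (f e - g e))" by (intro pre_intros assms)
  moreover have "1 - (f e - g e) = of_bool (f e \<le> g e)" for e by auto
  ultimately show ?thesis by simp
qed

lemma pre_eq [pre_intros]:
  assumes "prim_rec_env n f" "prim_rec_env n g"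
  shows "prim_rec_env_pred n (\<lambda>e. f e = g e)"
  unfolding eq_iff by (intro pre_intros assms)

lemma pre_finite_set:
  assumes "prim_rec_env n f" "finite S"
  shows "prim_rec_env_pred n (\<lambda>e. f e \<in> S)"
  using assms(2)
proof induction
  case empty
  show ?case by (simp add: pre_const)
next
  case (insert a S)
  then show ?case unfolding insert_iff by (intro pre_intros assms(1))
qed

lemma pre_finite_rel:
  assumes "prim_rec_env n f" "prim_rec_env n g" "finite R"
  shows "prim_rec_env_pred n (\<lambda>e. (f e, g e) \<in> R)"
  using assms(3)
proof induction
  case empty
  show ?case by (simp add: pre_const)
next
  case (insert p R)
  then show ?case
    unfolding insert_iff by (cases p) (simp only: prod.inject, intro pre_intros assms(1,2))
qed

lemma prim_rec_set_if_env:
  assumes "prim_rec_env_pred 1 (\<lambda>e. e 0 \<in> S)"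
  shows "prim_rec_set S"
proof -
  obtain f where f: "prim_rec 1 f" "\<And>e. of_bool (e 0 \<in> S) = f (map e [0..<1])"
    using assms by (auto simp: prim_rec_env_def)
  have "f [m] = (if m \<in> S then 1 else 0)" for m
    using f(2)[of "\<lambda>_. m"] by (simp add: of_bool_def)
  then show ?thesis using f(1) unfolding prim_rec_set_def by blast
qed

lemma prim_rec_rel_if_env:
  assumes "prim_rec_env_pred 2 (\<lambda>e. (e 0, e 1) \<in> R)"
  shows "prim_rec_rel R"
proof -
  obtain f where f: "prim_rec 2 f" "\<And>e. of_bool ((e 0, e 1) \<in> R) = f (map e [0..<2])"
    using assms by (auto simp: prim_rec_env_def)
  have "f [m, n] = (if (m, n) \<in> R then 1 else 0)" for m n
    using f(2)[of "case_nat m (\<lambda>_. n)"] by (simp add: of_bool_def numeral_2_eq_2)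
  then show ?thesis using f(1) unfolding prim_rec_rel_def by blast
qed

section \<open>Pairing\<close>

lemma pre_triangle [pre_intros]:
  assumes "prim_rec_env n f"
  shows "prim_rec_env n (\<lambda>e. triangle (f e))"
proof -
  have "rec_nat 0 (\<lambda>y z. z + Suc y) a = triangle a" for a
    by (induction a) (auto simp: triangle_def)
  moreover have "prim_rec_env n (\<lambda>e. rec_nat 0 (\<lambda>y z. z + Suc y) (f e))"
    by (intro pre_rec pre_intros assms) auto
  ultimately show ?thesis by simp
qed

lemma pre_prod_encode [pre_intros]:
  "prim_rec_env n f \<Longrightarrow> prim_rec_env n g \<Longrightarrow> prim_rec_env n (\<lambda>e. prod_encode (f e, g e))"
  unfolding prod_encode_def by simp (intro pre_intros)

text \<open>The sum \<open>a + b\<close> of the components of the pair coded by \<open>m = triangle (a + b) + a\<close>; it is the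
  largest number \<open>s\<close> with \<open>triangle s \<le> m\<close>.\<close>

definition diagonal :: "nat \<Rightarrow> nat" where
  "diagonal m = rec_nat 0 (\<lambda>y z. z + of_bool (triangle (Suc z) \<le> Suc y)) m"

lemma diagonal_bounds: "triangle (diagonal m) \<le> m \<and> m < triangle (Suc (diagonal m))"
proof (induction m)
  case 0
  show ?case by (simp add: diagonal_def)
next
  case (Suc m)
  have "diagonal (Suc m) = diagonal m + of_bool (triangle (Suc (diagonal m)) \<le> Suc m)"
    by (simp add: diagonal_def)
  then show ?case using Suc by (cases "triangle (Suc (diagonal m)) \<le> Suc m") auto
qed

lemma triangle_mono: "a \<le> b \<Longrightarrow> triangle a \<le> triangle b"
  by (induction b) (auto simp: le_Suc_eq)

lemma diagonal_prod_encode: "diagonal (prod_encode (a, b)) = a + b"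
proof -
  let ?m = "prod_encode (a, b)"
  have "triangle (a + b) \<le> ?m" "?m < triangle (Suc (a + b))"
    by (simp_all add: prod_encode_def)
  then have "triangle (diagonal ?m) < triangle (Suc (a + b))"
    "triangle (a + b) < triangle (Suc (diagonal ?m))"
    using diagonal_bounds[of ?m] by linarith+
  then have "\<not> Suc (a + b) \<le> diagonal ?m" "\<not> Suc (diagonal ?m) \<le> a + b"
    using triangle_mono not_le by blast+
  then show ?thesis by simp
qed

text \<open>The components of a coded pair.\<close>

definition pair_fst :: "nat \<Rightarrow> nat" where
  "pair_fst m = m - triangle (diagonal m)"

definition pair_snd :: "nat \<Rightarrow> nat" where
  "pair_snd m = diagonal m - pair_fst m"

lemma pair_fst_prod_encode [simp]: "pair_fst (prod_encode (a, b)) = a"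
  unfolding pair_fst_def diagonal_prod_encode by (simp add: prod_encode_def)

lemma pair_snd_prod_encode [simp]: "pair_snd (prod_encode (a, b)) = b"
  by (simp add: pair_snd_def diagonal_prod_encode)

lemma pair_cases: obtains a b where "m = prod_encode (a, b)"
  by (metis prod_decode_inverse surj_pair)

lemma pre_diagonal: "prim_rec_env n f \<Longrightarrow> prim_rec_env n (\<lambda>e. diagonal (f e))"
  unfolding diagonal_def by (intro pre_rec pre_intros) auto

lemma pre_pair_fst [pre_intros]: "prim_rec_env n f \<Longrightarrow> prim_rec_env n (\<lambda>e. pair_fst (f e))"
  unfolding pair_fst_def by (intro pre_intros pre_diagonal)

lemma pre_pair_snd [pre_intros]: "prim_rec_env n f \<Longrightarrow> prim_rec_env n (\<lambda>e. pair_snd (f e))"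
  unfolding pair_snd_def by (intro pre_intros pre_diagonal)

lemma pre_funpow_pair_snd [pre_intros]:
  assumes "prim_rec_env n f" "prim_rec_env n g"
  shows "prim_rec_env n (\<lambda>e. (pair_snd ^^ f e) (g e))"
proof -
  have "rec_nat b (\<lambda>_ z. pair_snd z) a = (pair_snd ^^ a) b" for a b by (induction a) auto
  moreover have "prim_rec_env n (\<lambda>e. rec_nat (g e) (\<lambda>_ z. pair_snd z) (f e))"
    by (intro pre_rec pre_intros assms) auto
  ultimately show ?thesis by simp
qed

section \<open>Codes of formulas\<close>

lemma range_fm_code_iff:
  "m \<in> range fm_code \<longleftrightarrow>
     pair_fst m = 0 \<or> pair_fst m = 1 \<and> pair_snd m = 0 \<or>
     (pair_fst m = 2 \<or> pair_fst m = 6) \<and> pair_snd m \<in> range fm_code \<or>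
     (pair_fst m = 3 \<or> pair_fst m = 4 \<or> pair_fst m = 5) \<and>
       pair_fst (pair_snd m) \<in> range fm_code \<and> pair_snd (pair_snd m) \<in> range fm_code"
  (is "_ \<longleftrightarrow> ?R")
proof
  assume "m \<in> range fm_code"
  then obtain A where "m = fm_code A" by auto
  then show ?R by (cases A) auto
next
  assume R: ?R
  obtain t u where m: "m = prod_encode (t, u)" by (rule pair_cases)
  obtain a b where u: "u = prod_encode (a, b)" by (rule pair_cases)
  consider "t = 0" | "t = 1" "u = 0" | "t = 2" "u \<in> range fm_code" | "t = 6" "u \<in> range fm_code"
    | "t = 3" "a \<in> range fm_code" "b \<in> range fm_code"
    | "t = 4" "a \<in> range fm_code" "b \<in> range fm_code"
    | "t = 5" "a \<in> range fm_code" "b \<in> range fm_code"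
    using R by (auto simp: m u)
  then show "m \<in> range fm_code"
  proof cases
    case 1
    then show ?thesis using m by (intro range_eqI[of _ _ "Var u"]) simp
  next
    case 2
    then show ?thesis using m by (intro range_eqI[of _ _ Bot]) simp
  next
    case 3
    then obtain A where "u = fm_code A" by auto
    then show ?thesis using m 3 by (intro range_eqI[of _ _ "Neg A"]) simp
  next
    case 4
    then obtain A where "u = fm_code A" by auto
    then show ?thesis using m 4 by (intro range_eqI[of _ _ "Box A"]) simp
  next
    case 5
    then obtain A B where "a = fm_code A" "b = fm_code B" by auto
    then show ?thesis using m u 5 by (intro range_eqI[of _ _ "And A B"]) simp
  next
    case 6
    then obtain A B where "a = fm_code A" "b = fm_code B" by auto
    then show ?thesis using m u 6 by (intro range_eqI[of _ _ "Or A B"]) simp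
  next
    case 7
    then obtain A B where "a = fm_code A" "b = fm_code B" by auto
    then show ?thesis using m u 7 by (intro range_eqI[of _ _ "Imp A B"]) simp
  qed
qed

text \<open>Being the code of a formula is decided by course-of-values recursion. The history up to \<open>m\<close> is
  the nested pair \<open>(c (m - 1), (c (m - 2), \<dots>))\<close> of the characteristic values \<open>c i\<close>. For \<open>i < m\<close>,
  the value \<open>c i\<close> is recovered from the history \<open>z\<close> by removing the \<open>m - (i + 1)\<close> later values.\<close>

definition lookup :: "nat \<Rightarrow> nat \<Rightarrow> nat \<Rightarrow> nat" where
  "lookup m z i = pair_fst ((pair_snd ^^ (m - Suc i)) z)"

text \<open>The condition of lemma \<open>range_fm_code_iff\<close> for \<open>m\<close>, with membership of smaller numbers read
  off the history \<open>z\<close> up to \<open>m\<close>.\<close>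

definition code_step :: "nat \<Rightarrow> nat \<Rightarrow> bool" where
  "code_step m z \<longleftrightarrow>
     pair_fst m = 0 \<or> pair_fst m = 1 \<and> pair_snd m = 0 \<or>
     (pair_fst m = 2 \<or> pair_fst m = 6) \<and> lookup m z (pair_snd m) = 1 \<or>
     (pair_fst m = 3 \<or> pair_fst m = 4 \<or> pair_fst m = 5) \<and>
       lookup m z (pair_fst (pair_snd m)) = 1 \<and> lookup m z (pair_snd (pair_snd m)) = 1"

text \<open>The history up to \<open>m\<close>; the empty history is coded by \<open>0\<close>.\<close>

definition code_history :: "nat \<Rightarrow> nat" where
  "code_history m = rec_nat 0 (\<lambda>y z. prod_encode (of_bool (code_step y z), z)) m"

lemma code_history_Suc:
  "code_history (Suc m) = prod_encode (of_bool (code_step m (code_history m)), code_history m)"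
  by (simp add: code_history_def)

lemma lookup_code_history:
  assumes "i < m"
  shows "lookup m (code_history m) i = of_bool (code_step i (code_history i))"
proof -
  have "(pair_snd ^^ j) (code_history (k + j)) = code_history k" for j k :: nat
    by (induction j) (simp_all add: code_history_Suc funpow_swap1)
  from this[of "m - Suc i" "Suc i"] show ?thesis
    using assms by (simp add: lookup_def code_history_Suc)
qed

lemma pair_snd_less:
  assumes "pair_fst m \<noteq> 0"
  shows "pair_snd m < m"
proof -
  obtain a b where m: "m = prod_encode (a, b)" by (rule pair_cases)
  have "s \<le> triangle s" for s by (induction s) auto
  from this[of "a + b"] have "b < prod_encode (a, b)" if "a \<noteq> 0"
    using that by (simp add: prod_encode_def)
  then show ?thesis using assms m by simp
qed

lemma pair_le: "pair_fst m \<le> m" "pair_snd m \<le> m"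
  by (rule pair_cases[of m]; simp add: le_prod_encode_1 le_prod_encode_2)+

lemma code_step_iff: "code_step m (code_history m) \<longleftrightarrow> m \<in> range fm_code"
proof (induction m rule: less_induct)
  case (less m)
  have look: "lookup m (code_history m) i = 1 \<longleftrightarrow> i \<in> range fm_code" if "i < m" for i
    using less[OF that] lookup_code_history[OF that] by simp
  show ?case
  proof (cases "pair_fst m = 0")
    case True
    then show ?thesis by (subst range_fm_code_iff) (simp add: code_step_def)
  next
    case False
    then have "pair_snd m < m" by (rule pair_snd_less)
    moreover from this have "pair_fst (pair_snd m) < m" "pair_snd (pair_snd m) < m"
      using pair_le[of "pair_snd m"] by linarith+
    ultimately show ?thesis
      by (subst range_fm_code_iff) (simp only: code_step_def look)
  qed
qed

lemma pre_fm_code [pre_intros]: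
  assumes "prim_rec_env n f"
  shows "prim_rec_env_pred n (\<lambda>e. f e \<in> range fm_code)"
proof -
  have step: "prim_rec_env_pred k (\<lambda>e. code_step (g e) (h e))"
    if "prim_rec_env k g" "prim_rec_env k h" for k g h
    unfolding code_step_def lookup_def by (intro pre_intros that)
  have "prim_rec_env n (\<lambda>e. code_history (f e))"
    unfolding code_history_def by (intro pre_rec pre_intros step assms) auto
  then have "prim_rec_env_pred n (\<lambda>e. code_step (f e) (code_history (f e)))"
    by (intro step assms)
  then show ?thesis by (simp only: code_step_iff)
qed

lemma pair_fst_fm_code_eq_2: "pair_fst (fm_code B) = 2 \<longleftrightarrow> (\<exists>A. B = Neg A)"
  by (cases B) auto

lemma prim_rec_presented_countermodel:
  assumes S: "finite S" and W: "finite W"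
  shows "prim_rec_presented (countermodel \<Lambda> S W r)"
proof -
  let ?M = "countermodel \<Lambda> S W r"
  obtain k :: "_ \<Rightarrow> nat" where k: "inj_on k W"
    using finite_imp_inj_to_nat_seg[OF W] by blast
  have worlds: "worlds ?M = W" by (simp add: countermodel_def)
  have "prim_rec_set (k ` W)"
    by (intro prim_rec_set_if_env pre_finite_set pre_intros) (use W in auto)
  moreover have "prim_rec_rel {(k x, fm_code (Var n)) | x n. x \<in> W \<and> forces ?M x (Var n)}"
    (is "prim_rec_rel ?R")
  proof -
    have "?R \<subseteq> k ` W \<times> fm_code ` S"
      by (auto simp: countermodel_def simp del: fm_code.simps)
    then have "finite ?R" using S W by (meson finite_SigmaI finite_imageI finite_subset)
    then show ?thesis
      by (intro prim_rec_rel_if_env pre_finite_rel pre_intros) auto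
  qed
  moreover have "prim_rec_rel {(k x, fm_code B) | x B. x \<in> W \<and> B \<in> clo ?M (gen ?M x)}"
    (is "prim_rec_rel ?R")
  proof -
    let ?R1 = "{(k x, fm_code B) | x B. x \<in> W \<and> B \<in> S \<and> r x (Box B)}"
    have "?R1 \<subseteq> k ` W \<times> fm_code ` S" by auto
    then have fin: "finite ?R1" using S W by (meson finite_SigmaI finite_imageI finite_subset)
    \<comment> \<open>2 is the tag of negations in codes of formulas\<close>
    have eq: "(i, m) \<in> ?R \<longleftrightarrow> (i, m) \<in> ?R1 \<or>
        i \<in> k ` W \<and> m \<in> range fm_code \<and> m \<notin> fm_code ` S \<and>
          (N \<in> \<Lambda> \<or> pair_fst m \<noteq> 2)" for i m
      by (auto simp: countermodel_def boxed_outside_def pair_fst_fm_code_eq_2 fm_code_inject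
          simp del: fm_code.simps)
    show ?thesis
      by (rule prim_rec_rel_if_env, unfold eq,
          intro pre_intros pre_finite_rel pre_finite_set fin) (use S W in auto)
  qed
  ultimately show ?thesis
    unfolding prim_rec_presented_def worlds using k by blast
qed

section \<open>Completeness\<close>

lemma completeness:
  assumes inf: "infinite (UNIV :: 'w set)" and ND: "\<not> {N, D} \<subseteq> \<Lambda>" and A: "A \<notin> logic \<Lambda>"
  obtains M :: "'w closure_model" where "closure_model M" "finite_model M"
    "prim_rec_presented M" "\<forall>X\<in>\<Lambda>. satisfies M X" "\<not> valid M A"
proof -
  define S where "S = insert Bot (subfms A)"
  have S: "finite S" "subformula_closed S" "Bot \<in> S" "A \<in> S"
    using subfms_trans[of _ A] finite_subfms subfms_refl
    by (auto simp: S_def subformula_closed_def)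
  let ?V = "theory_valuations (logic \<Lambda>)"
  obtain W :: "'w set" and r where W: "finite W" and r: "\<And>x. x \<in> W \<Longrightarrow> r x \<in> ?V"
    and rep: "\<And>v. v \<in> ?V \<Longrightarrow> \<exists>x\<in>W. \<forall>B\<in>S. r x B = v B"
    using finite_representatives[OF inf S(1), of ?V] by blast
  obtain v where "v \<in> ?V" "\<not> v A" using lindenbaum[OF modal_logic_logic A] .
  then obtain x where x: "x \<in> W" "\<not> r x A" using rep S(4) by blast
  let ?M = "countermodel \<Lambda> S W r"
  have "boolean_clauses (r x)" using r x by (simp add: theory_valuations_def)
  then have "\<not> forces ?M x A" using truth_lemma[of S r x A \<Lambda> W] S x by simp
  then have "\<not> valid ?M A" using x by (auto simp: valid_def countermodel_def)
  moreover have "\<forall>X\<in>\<Lambda>. satisfies ?M X"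
  proof
    fix X assume "X \<in> \<Lambda>"
    have "W \<noteq> {}" using x by blast
    from S(2,3) this r rep ND \<open>X \<in> \<Lambda>\<close> show "satisfies ?M X"
      by (rule satisfies_countermodel)
  qed
  moreover have "closure_model ?M" "finite_model ?M" "prim_rec_presented ?M"
    using S W x
    by (auto intro: closure_model_countermodel finite_model_countermodel
        prim_rec_presented_countermodel)
  ultimately show ?thesis using that by blast
qed

theorem theorem3p15:
  fixes \<Lambda> :: "principle set" and A :: fm
  assumes "infinite (UNIV :: 'w set)"
    and "\<not> {N, D} \<subseteq> \<Lambda>"
  shows "(A \<in> logic \<Lambda> \<longleftrightarrow>
            (\<forall>M :: 'w closure_model.
               closure_model M \<and> (\<forall>X\<in>\<Lambda>. satisfies M X) \<longrightarrow> valid M A)) \<and>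
         (A \<in> logic \<Lambda> \<longleftrightarrow>
            (\<forall>M :: 'w closure_model.
               closure_model M \<and> finite_model M \<and> prim_rec_presented M \<and>
               (\<forall>X\<in>\<Lambda>. satisfies M X) \<longrightarrow> valid M A))"
  using assms soundness completeness by metis

end
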